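(* Consider the max-min problem $$\max_{\Pi}\ \min_{\Xi}\ U(\Pi,\Xi)$$ subject to the constraints listed in the context, and the associated two-person zero-sum game $G$. This max-min problem yields the same solution as its minimax counterpart, i.e. $\min_{\Xi}\max_{\Pi}U(\Pi,\Xi)$ subject to the same set of constraints. Thus, there exists a saddle-point Nash equilibrium of the game $G$, i.e. a feasible strategy pair $\{\Pi^*,\Xi^*\}$ such that $$U(\Pi,\Xi^* )\le U(\Pi^*,\Xi^* )\le U(\Pi^*,\Xi)\qquad\text{for all feasible }\Pi,\ \Xi.$$ However, such an equilibrium is not necessarily unique.
   Context: $\mathcal{X}=\{1,\dots,|\mathcal{X}|\}$ (targets) and $\mathcal{Y}=\{1,\dots,|\mathcal{Y}|\}$ (sources) are the two sides of a bipartite graph, not necessarily complete, with edge set $\mathcal{E}$. For $y\in\mathcal{Y}$, $\mathcal{X}_y$ is the set of targets connected to $y$, and for $x\in\mathcal{X}$, $\mathcal{Y}_x$ is the set of sources connected to $x$; all these sets are nonempty, and $\mathcal{E}=\{\{x,y\}: x\in\mathcal{X}_y,\ y\in\mathcal{Y}\}$. $\mathcal{X}_a\subseteq\mathcal{X}$ is the set of targets compromised by the attacker and $\mathcal{X}_o=\mathcal{X}\setminus\mathcal{X}_a$. Parameters: $\delta_{xy},\gamma_{xy}\ge 0$ for $\{x,y\}\in\mathcal{E}$; $\bar p_x\ge\underline p_x\ge 0$ for $x\in\mathcal{X}$; $\bar q_y\ge\underline q_y\ge 0$ for $y\in\mathcal{Y}$; $c_a\ge 0$. The planner's strategy (transport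 plan) is $\Pi=\{\pi_{xy}\}_{x\in\mathcal{X}_y,y\in\mathcal{Y}}$. The attacker's strategy is $\Xi=\{\xi_{xy}\}_{x\in\mathcal{X}_a,y\in\mathcal{Y}_x}$, and $\boldsymbol{\xi}_x=(\xi_{xy})_{y\in\mathcal{Y}_x}$ for $x\in\mathcal{X}_a$. The constraints are - $\underline p_x\le\sum_{y\in\mathcal{Y}_x}\pi_{xy}\le\bar p_x$ for all $x\in\mathcal{X}$, - $\underline q_y\le\sum_{x\in\mathcal{X}_y}\pi_{xy}\le\bar q_y$ for all $y\in\mathcal{Y}$, - $\pi_{xy}\ge 0$ for all $\{x,y\}\in\mathcal{E}$, - $\boldsymbol{\xi}_x\in\mathcal{A}_x$ for all $x\in\mathcal{X}_a$, where $\mathcal{A}_x$ is the attacker's feasible action set on target $x$. One form that $\mathcal{A}_x$ can be chosen to take is $\mathcal{A}_x=\{\boldsymbol{\xi}_x:\ \Vert\boldsymbol{\xi}_x\Vert_2^2\le\kappa_x,\ \boldsymbol{\xi}_x+\boldsymbol{\delta}_x\ge\boldsymbol{0}\}$ with $\kappa_x\ge 0$ and $\boldsymbol{\delta}_x=(\delta_{xy})_{y\in\mathcal{Y}_x}$ (inequality componentwise). The objective is $$U(\Pi,\Xi)=\sum_{x\in\mathcal{X}_o}\sum_{y\in\mathcal{Y}_x}\delta_{xy}\pi_{xy}+\sum_{y\in\mathcal{Y}}\sum_{x\in\mathcal{X}_y}\gamma_{xy}\pi_{xy}+\sum_{x\in\mathcal{X}_a}\sum_{y\in\mathcal{Y}_x}(\delta_{xy}+\xi_{xy})\pi_{xy}+c_a\sum_{x\in\mathcal{X}_a}\Vert\boldsymbol{\xi}_x\Vert_1.$$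 In the game $G$ the transport planner chooses $\Pi$ to maximize $U$ and the attacker chooses $\Xi$ to minimize $U$, subject to the constraints above.
   Formalization: The attacker's action sets are assumed nonempty, compact and convex (as the displayed norm-bounded form is) and a feasible transport plan is assumed to exist; for arbitrary action sets the claim fails. *)

theory Defs
  imports "HOL-Analysis.Analysis"
begin

text \<open>
  Targets and sources are the elements of two finite types. Both players' strategies are matrices
  indexed by target and source; the players choose only the entries on the relevant edges, and
  all other entries are pinned to 0, so that equality of matrices is equality of strategies.
  The values of the parameters outside the edge set are never used.
\<close>

record ('x, 'y) transport_game =
  edges :: "('x \<times> 'y) set"
  compromised :: "'x set"
  delta :: "'x \<Rightarrow> 'y \<Rightarrow> real"
  gamma :: "'x \<Rightarrow> 'y \<Rightarrow> real"
  p_lower :: "'x \<Rightarrow> real"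
  p_upper :: "'x \<Rightarrow> real"
  q_lower :: "'y \<Rightarrow> real"
  q_upper :: "'y \<Rightarrow> real"
  attack_cost :: real
  actions :: "'x \<Rightarrow> (real ^ 'y) set"

definition targets_of :: "('x::finite, 'y::finite) transport_game \<Rightarrow> 'y \<Rightarrow> 'x set" where
  "targets_of G y = {x. (x, y) \<in> edges G}"

definition sources_of :: "('x::finite, 'y::finite) transport_game \<Rightarrow> 'x \<Rightarrow> 'y set" where
  "sources_of G x = {y. (x, y) \<in> edges G}"

text \<open>
  The coordinate subspace of vectors \<open>(v\<^sub>y)\<close> indexed by the sources of \<open>x\<close>, embedded by zeros.
\<close>
definition source_vectors :: "('x::finite, 'y::finite) transport_game \<Rightarrow> 'x \<Rightarrow> (real ^ 'y) set" where
  "source_vectors G x = {v. \<forall>y. y \<notin> sources_of G x \<longrightarrow> v $ y = 0}"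

definition valid_game :: "('x::finite, 'y::finite) transport_game \<Rightarrow> bool" where
  "valid_game G \<longleftrightarrow>
     (\<forall>y. targets_of G y \<noteq> {}) \<and>
     (\<forall>x. sources_of G x \<noteq> {}) \<and>
     (\<forall>(x, y)\<in>edges G. 0 \<le> delta G x y \<and> 0 \<le> gamma G x y) \<and>
     (\<forall>x. 0 \<le> p_lower G x \<and> p_lower G x \<le> p_upper G x) \<and>
     (\<forall>y. 0 \<le> q_lower G y \<and> q_lower G y \<le> q_upper G y) \<and>
     0 \<le> attack_cost G \<and>
     (\<forall>x\<in>compromised G. actions G x \<subseteq> source_vectors G x)"

definition plans :: "('x::finite, 'y::finite) transport_game \<Rightarrow> (real ^ 'y ^ 'x) set" where
  "plans G = {\<pi>.
     (\<forall>x. p_lower G x \<le> (\<Sum>y\<in>sources_of G x. \<pi> $ x $ y) \<and>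
          (\<Sum>y\<in>sources_of G x. \<pi> $ x $ y) \<le> p_upper G x) \<and>
     (\<forall>y. q_lower G y \<le> (\<Sum>x\<in>targets_of G y. \<pi> $ x $ y) \<and>
          (\<Sum>x\<in>targets_of G y. \<pi> $ x $ y) \<le> q_upper G y) \<and>
     (\<forall>(x, y)\<in>edges G. 0 \<le> \<pi> $ x $ y) \<and>
     (\<forall>x y. (x, y) \<notin> edges G \<longrightarrow> \<pi> $ x $ y = 0)}"

definition attacks :: "('x::finite, 'y::finite) transport_game \<Rightarrow> (real ^ 'y ^ 'x) set" where
  "attacks G = {\<xi>.
     (\<forall>x\<in>compromised G. \<xi> $ x \<in> actions G x) \<and>
     (\<forall>x y. x \<notin> compromised G \<or> (x, y) \<notin> edges G \<longrightarrow> \<xi> $ x $ y = 0)}"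

definition payoff :: "('x::finite, 'y::finite) transport_game \<Rightarrow> real ^ 'y ^ 'x \<Rightarrow> real ^ 'y ^ 'x \<Rightarrow> real"
  where
  "payoff G \<pi> \<xi> =
     (\<Sum>x\<in>- compromised G. \<Sum>y\<in>sources_of G x. delta G x y * \<pi> $ x $ y) +
     (\<Sum>y\<in>UNIV. \<Sum>x\<in>targets_of G y. gamma G x y * \<pi> $ x $ y) +
     (\<Sum>x\<in>compromised G. \<Sum>y\<in>sources_of G x. (delta G x y + \<xi> $ x $ y) * \<pi> $ x $ y) +
     attack_cost G * (\<Sum>x\<in>compromised G. \<Sum>y\<in>sources_of G x. \<bar>\<xi> $ x $ y\<bar>)"

definition min_payoff :: "('x::finite, 'y::finite) transport_game \<Rightarrow> real ^ 'y ^ 'x \<Rightarrow> real" where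
  "min_payoff G \<pi> = (INF \<xi>\<in>attacks G. payoff G \<pi> \<xi>)"

definition max_payoff :: "('x::finite, 'y::finite) transport_game \<Rightarrow> real ^ 'y ^ 'x \<Rightarrow> real" where
  "max_payoff G \<xi> = (SUP \<pi>\<in>plans G. payoff G \<pi> \<xi>)"

text \<open>
  Infima and suprema of real sets are meaningful only for bounded sets. The two solution notions
  below are meant to be read together with the attainment of all inner optima.
\<close>

definition inner_optima_attained :: "('x::finite, 'y::finite) transport_game \<Rightarrow> bool" where
  "inner_optima_attained G \<longleftrightarrow>
     (\<forall>\<pi>\<in>plans G. \<exists>\<xi>. is_arg_min (\<lambda>\<xi>. payoff G \<pi> \<xi>) (\<lambda>\<xi>. \<xi> \<in> attacks G) \<xi>) \<and>
     (\<forall>\<xi>\<in>attacks G. \<exists>\<pi>. is_arg_max (\<lambda>\<pi>. payoff G \<pi> \<xi>) (\<lambda>\<pi>. \<pi> \<in> plans G) \<pi>)"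

definition max_min_solution ::
    "('x::finite, 'y::finite) transport_game \<Rightarrow> real ^ 'y ^ 'x \<Rightarrow> real ^ 'y ^ 'x \<Rightarrow> bool" where
  "max_min_solution G \<pi> \<xi> \<longleftrightarrow>
     is_arg_max (min_payoff G) (\<lambda>\<pi>. \<pi> \<in> plans G) \<pi> \<and>
     is_arg_min (\<lambda>\<xi>. payoff G \<pi> \<xi>) (\<lambda>\<xi>. \<xi> \<in> attacks G) \<xi>"

definition min_max_solution ::
    "('x::finite, 'y::finite) transport_game \<Rightarrow> real ^ 'y ^ 'x \<Rightarrow> real ^ 'y ^ 'x \<Rightarrow> bool" where
  "min_max_solution G \<pi> \<xi> \<longleftrightarrow>
     is_arg_min (max_payoff G) (\<lambda>\<xi>. \<xi> \<in> attacks G) \<xi> \<and>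
     is_arg_max (\<lambda>\<pi>. payoff G \<pi> \<xi>) (\<lambda>\<pi>. \<pi> \<in> plans G) \<pi>"

definition saddle_point ::
    "('x::finite, 'y::finite) transport_game \<Rightarrow> real ^ 'y ^ 'x \<Rightarrow> real ^ 'y ^ 'x \<Rightarrow> bool" where
  "saddle_point G \<pi>\<^sub>s \<xi>\<^sub>s \<longleftrightarrow>
     \<pi>\<^sub>s \<in> plans G \<and> \<xi>\<^sub>s \<in> attacks G \<and>
     (\<forall>\<pi>\<in>plans G. \<forall>\<xi>\<in>attacks G.
        payoff G \<pi> \<xi>\<^sub>s \<le> payoff G \<pi>\<^sub>s \<xi>\<^sub>s \<and> payoff G \<pi>\<^sub>s \<xi>\<^sub>s \<le> payoff G \<pi>\<^sub>s \<xi>)"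

definition ball_actions ::
    "('x::finite, 'y::finite) transport_game \<Rightarrow> real \<Rightarrow> 'x \<Rightarrow> (real ^ 'y) set" where
  "ball_actions G \<kappa> x =
     {v \<in> source_vectors G x. (norm v)\<^sup>2 \<le> \<kappa> \<and> (\<forall>y\<in>sources_of G x. 0 \<le> v $ y + delta G x y)}"

lemma ball_actions_nonempty_compact_convex:
  fixes G :: "('x::finite, 'y::finite) transport_game"
  assumes "valid_game G" and "0 \<le> \<kappa>"
  shows "ball_actions G \<kappa> x \<noteq> {}" "compact (ball_actions G \<kappa> x)" "convex (ball_actions G \<kappa> x)"
proof -
  have norm_le: "(norm v)\<^sup>2 \<le> \<kappa> \<longleftrightarrow> norm v \<le> sqrt \<kappa>" for v :: "real ^ 'y"
    using real_sqrt_le_iff[of "(norm v)\<^sup>2" \<kappa>] by simp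
  have eq: "ball_actions G \<kappa> x = cball 0 (sqrt \<kappa>)
      \<inter> (\<Inter>y\<in>- sources_of G x. {v. v $ y = 0})
      \<inter> (\<Inter>y\<in>sources_of G x. {v. 0 \<le> v $ y + delta G x y})"
    by (auto simp: ball_actions_def source_vectors_def norm_le)
  have "(0 :: real ^ 'y) \<in> ball_actions G \<kappa> x"
    using assms by (auto simp: ball_actions_def source_vectors_def valid_game_def sources_of_def)
  then show "ball_actions G \<kappa> x \<noteq> {}" by blast
  have "closed (\<Inter>y\<in>- sources_of G x. {v :: real ^ 'y. v $ y = 0})"
    by (intro closed_INT ballI closed_Collect_eq continuous_intros)
  moreover have "closed (\<Inter>y\<in>sources_of G x. {v :: real ^ 'y. 0 \<le> v $ y + delta G x y})"
    by (intro closed_INT ballI closed_Collect_le continuous_intros)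
  ultimately show "compact (ball_actions G \<kappa> x)"
    unfolding eq by (intro compact_Int_closed compact_cball)
  have "convex {v :: real ^ 'y. v $ y = 0}" for y
    by (simp add: convex_def)
  moreover have "convex {v :: real ^ 'y. 0 \<le> v $ y + delta G x y}" for y
  proof (rule convexI)
    fix v w :: "real ^ 'y" and s t :: real
    assume h: "v \<in> {v. 0 \<le> v $ y + delta G x y}" "w \<in> {v. 0 \<le> v $ y + delta G x y}"
      and st: "0 \<le> s" "0 \<le> t" "s + t = 1"
    have "(s *\<^sub>R v + t *\<^sub>R w) $ y + delta G x y
        = s * (v $ y + delta G x y) + t * (w $ y + delta G x y)"
      using st(3) by (simp add: algebra_simps flip: distrib_right)
    moreover have "0 \<le> \<dots>" using h st by simp
    ultimately show "s *\<^sub>R v + t *\<^sub>R w \<in> {v. 0 \<le> v $ y + delta G x y}" by simp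
  qed
  ultimately show "convex (ball_actions G \<kappa> x)"
    unfolding eq by (intro convex_Int convex_INT convex_cball)
qed

end

theory Submission
  imports Defs
begin

text \<open>
  On feasible strategies the payoff has the form \<open>\<pi> \<bullet> (D + \<xi>) + h \<xi>\<close> with \<open>h\<close> convex. Let \<open>v\<close> be the
  min-max value, which is attained by compactness. In the space of pairs \<open>(a, t)\<close>, thought of as
  affine functions \<open>\<pi> \<mapsto> \<pi> \<bullet> a + t\<close>, the convex set of functions lying above some payoff function
  of the attacker is disjoint from the convex set of functions smaller than \<open>v\<close> on all plans.
  A separating hyperplane cannot be vertical, and its normalised normal vector is a plan that
  guarantees the planner the value \<open>v\<close>. Non-uniqueness is witnessed by a game with zero payoff.
\<close>

section \<open>A minimax theorem for a bilinear term plus a convex term\<close>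

text \<open>A sequence of near-optimal points of the compact set \<open>Q\<close> has a convergent
  subsequence, and for each \<pi> separately the inequality passes to the limit by continuity of
  \<open>f \<pi>\<close>. The last two conclusions say that \<open>v\<close> is the infimum over
  \<open>Q\<close> of the suprema over \<open>P\<close>, phrased by upper bounds.\<close>

lemma min_max_attained:
  fixes f :: "'a \<Rightarrow> 'b::metric_space \<Rightarrow> real"
  assumes Q: "compact Q" "Q \<noteq> {}" and P: "P \<noteq> {}"
    and bdd: "\<And>\<xi>. \<xi> \<in> Q \<Longrightarrow> bdd_above ((\<lambda>\<pi>. f \<pi> \<xi>) ` P)"
    and cont: "\<And>\<pi>. \<pi> \<in> P \<Longrightarrow> continuous_on Q (f \<pi>)"
  obtains v \<xi>0 where "\<xi>0 \<in> Q" "\<And>\<pi>. \<pi> \<in> P \<Longrightarrow> f \<pi> \<xi>0 \<le> v"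
    "\<And>\<xi> c. \<xi> \<in> Q \<Longrightarrow> (\<And>\<pi>. \<pi> \<in> P \<Longrightarrow> f \<pi> \<xi> \<le> c) \<Longrightarrow> v \<le> c"
proof -
  define C where "C = {c. \<exists>\<xi>\<in>Q. \<forall>\<pi>\<in>P. f \<pi> \<xi> \<le> c}"
  obtain \<pi>0 where \<pi>0: "\<pi>0 \<in> P" using P by blast
  \<comment> \<open>The minimum of \<open>f \<pi>0\<close> for one fixed plan is a lower bound of
    \<open>C\<close>.\<close>
  obtain \<eta> where \<eta>: "\<eta> \<in> Q" "\<And>\<xi>. \<xi> \<in> Q \<Longrightarrow> f \<pi>0 \<eta> \<le> f \<pi>0 \<xi>"
    using continuous_attains_inf[OF Q cont[OF \<pi>0]] by blast
  have bdd_C: "bdd_below C"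
    unfolding C_def by (rule bdd_belowI[of _ "f \<pi>0 \<eta>"]) (use \<eta> \<pi>0 order_trans in blast)
  have "C \<noteq> {}"
    using bdd[OF \<eta>(1)] \<eta>(1) by (auto simp: C_def bdd_above_def)
  have "\<exists>\<xi>\<in>Q. \<forall>\<pi>\<in>P. f \<pi> \<xi> \<le> Inf C + inverse (real (Suc n))" for n
  proof -
    have "Inf C < Inf C + inverse (real (Suc n))" by simp
    then obtain c where "c \<in> C" "c < Inf C + inverse (real (Suc n))"
      using cInf_lessD[OF \<open>C \<noteq> {}\<close>] by blast
    then show ?thesis unfolding C_def by force
  qed
  then obtain X where X: "\<And>n. X n \<in> Q" "\<And>n \<pi>. \<pi> \<in> P \<Longrightarrow> f \<pi> (X n) \<le> Inf C + inverse (real (Suc n))"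
    by metis
  obtain l r where l: "l \<in> Q" "strict_mono (r :: nat \<Rightarrow> nat)" "(X \<circ> r) \<longlonglongrightarrow> l"
    using Q(1) X(1) unfolding compact_def by metis
  have "f \<pi> l \<le> Inf C" if "\<pi> \<in> P" for \<pi>
  proof (rule LIMSEQ_le)
    show "(\<lambda>n. f \<pi> ((X \<circ> r) n)) \<longlonglongrightarrow> f \<pi> l"
      using continuous_on_tendsto_compose[OF cont[OF that] l(3) l(1)] X(1) by simp
    show "(\<lambda>n. Inf C + inverse (real (Suc (r n)))) \<longlonglongrightarrow> Inf C"
      using tendsto_add[OF tendsto_const LIMSEQ_subseq_LIMSEQ[OF LIMSEQ_inverse_real_of_nat l(2)], of "Inf C"]
      by (simp add: o_def)
    show "\<exists>N. \<forall>n\<ge>N. f \<pi> ((X \<circ> r) n) \<le> Inf C + inverse (real (Suc (r n)))"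
      using X(2)[OF that] by simp
  qed
  moreover have "Inf C \<le> c" if "\<xi> \<in> Q" "\<And>\<pi>. \<pi> \<in> P \<Longrightarrow> f \<pi> \<xi> \<le> c" for \<xi> c
    by (rule cInf_lower[OF _ bdd_C]) (use that C_def in blast)
  ultimately show thesis using that[OF l(1)] by blast
qed

text \<open>Exchanges quantifiers: the plan that reaches \<open>v\<close> in the last hypothesis may
  depend on \<xi>, whereas \<open>p\<close> serves all \<xi> at once.\<close>

lemma maximin_strategy:
  fixes L :: "'b::euclidean_space \<Rightarrow> 'a::euclidean_space"
  assumes P: "compact P" "convex P" and Q: "convex Q" "Q \<noteq> {}"
    and L: "linear L" and h: "convex_on Q h"
    and v: "\<And>\<xi>. \<xi> \<in> Q \<Longrightarrow> \<exists>\<pi>\<in>P. v \<le> \<pi> \<bullet> (d + L \<xi>) + h \<xi>"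
  obtains p where "p \<in> P" "\<And>\<xi>. \<xi> \<in> Q \<Longrightarrow> v \<le> p \<bullet> (d + L \<xi>) + h \<xi>"
proof -
  \<comment> \<open>Taking \<open>h \<xi> \<le> t\<close> instead of equality makes \<open>S\<close>
    epigraph-like, so convexity of \<open>h\<close> yields convexity of \<open>S\<close>. The strict
    inequality in \<open>T\<close> makes the two sets disjoint.\<close>
  define S where "S = {(a, t). \<exists>\<xi>\<in>Q. a = d + L \<xi> \<and> h \<xi> \<le> t}"
  define T where "T = {(a, t). \<forall>\<pi>\<in>P. \<pi> \<bullet> a + t < v}"
  have "convex S"
  proof (rule convexI)
    fix x y :: "'a \<times> real" and u w :: real
    assume x: "x \<in> S" and y: "y \<in> S" and uw: "0 \<le> u" "0 \<le> w" "u + w = 1"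
    obtain \<xi> \<eta> where \<xi>: "\<xi> \<in> Q" "fst x = d + L \<xi>" "h \<xi> \<le> snd x"
      and \<eta>: "\<eta> \<in> Q" "fst y = d + L \<eta>" "h \<eta> \<le> snd y"
      using x y by (auto simp: S_def)
    have "u *\<^sub>R \<xi> + w *\<^sub>R \<eta> \<in> Q"
      using Q(1) \<xi> \<eta> uw by (simp add: convexD)
    moreover have "u *\<^sub>R fst x + w *\<^sub>R fst y = d + L (u *\<^sub>R \<xi> + w *\<^sub>R \<eta>)"
      using uw(3) by (simp add: \<xi> \<eta> linear_add[OF L] linear_cmul[OF L] algebra_simps
          flip: scaleR_add_left)
    moreover have "h (u *\<^sub>R \<xi> + w *\<^sub>R \<eta>) \<le> u * snd x + w * snd y"
    proof -
      have "h (u *\<^sub>R \<xi> + w *\<^sub>R \<eta>) \<le> u * h \<xi> + w * h \<eta>"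
        using h \<xi> \<eta> uw unfolding convex_on_def by blast
      also have "\<dots> \<le> u * snd x + w * snd y"
        using \<xi> \<eta> uw by (intro add_mono mult_left_mono)
      finally show ?thesis .
    qed
    ultimately show "u *\<^sub>R x + w *\<^sub>R y \<in> S"
      unfolding S_def by (cases x; cases y) auto
  qed
  have "convex T"
  proof (rule convexI)
    fix x y :: "'a \<times> real" and u w :: real
    assume x: "x \<in> T" and y: "y \<in> T" and uw: "0 \<le> u" "0 \<le> w" "u + w = 1"
    have "\<pi> \<bullet> (u *\<^sub>R fst x + w *\<^sub>R fst y) + (u * snd x + w * snd y) < v" if "\<pi> \<in> P" for \<pi>
    proof -
      have "u * (\<pi> \<bullet> fst x + snd x) + w * (\<pi> \<bullet> fst y + snd y) < v"
        using x y that uw by (intro convex_bound_lt) (auto simp: T_def)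
      then show ?thesis by (simp add: inner_simps algebra_simps)
    qed
    then show "u *\<^sub>R x + w *\<^sub>R y \<in> T"
      unfolding T_def by (cases x; cases y) auto
  qed
  obtain R where R: "\<And>\<pi>. \<pi> \<in> P \<Longrightarrow> norm \<pi> \<le> R"
    using compact_imp_bounded[OF P(1)] by (auto simp: bounded_iff)
  \<comment> \<open>By Cauchy-Schwarz with the bound \<open>R\<close> on \<open>P\<close>, every
    \<open>a\<close> becomes the first component of a member of \<open>T\<close> once
    \<open>t\<close> is low enough. These members fix the sign of \<open>s\<close> and the bound on
    \<open>v\<close> below.\<close>
  have T_I: "(a, t) \<in> T" if "t < v - R * norm a" for a t
    unfolding T_def
  proof clarsimp
    fix \<pi> assume "\<pi> \<in> P"
    then have "\<pi> \<bullet> a \<le> R * norm a"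
      using norm_cauchy_schwarz[of \<pi> a] mult_right_mono[OF R, of \<pi> "norm a"] by simp
    then show "\<pi> \<bullet> a + t < v" using that by simp
  qed
  have "S \<inter> T = {}"
  proof -
    have False if "\<xi> \<in> Q" "h \<xi> \<le> t" "\<forall>\<pi>\<in>P. \<pi> \<bullet> (d + L \<xi>) + t < v" for \<xi> t
      using v[OF that(1)] that by force
    then show ?thesis by (auto simp: S_def T_def)
  qed
  moreover have "S \<noteq> {}" using Q(2) by (auto simp: S_def)
  moreover have "T \<noteq> {}" using T_I[of "v - 1" 0] by auto
  ultimately obtain n c where n: "n \<noteq> 0" "\<forall>x\<in>T. n \<bullet> x \<le> c" "\<forall>x\<in>S. n \<bullet> x \<ge> c"
    using separating_hyperplane_sets[OF \<open>convex T\<close> \<open>convex S\<close>] by blast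
  define b s where "b = fst n" and "s = snd n"
  have T_le: "b \<bullet> a + s * t \<le> c" if "(a, t) \<in> T" for a t
    using n(2) that by (force simp: b_def s_def inner_prod_def)
  have S_ge: "c \<le> b \<bullet> (d + L \<xi>) + s * h \<xi>" if "\<xi> \<in> Q" for \<xi>
  proof -
    have "(d + L \<xi>, h \<xi>) \<in> S" using that by (auto simp: S_def)
    then show ?thesis using n(3) by (force simp: b_def s_def inner_prod_def)
  qed
  \<comment> \<open>\<open>T\<close> contains \<open>(0, t)\<close> for all \<open>t < v\<close>. If
    \<open>s\<close> were negative, the chosen \<open>t\<close> would give
    \<open>s * t \<ge> c + 1\<close>, beyond the separating bound \<open>c\<close>.\<close>
  have "0 \<le> s"
  proof (rule ccontr)
    assume "\<not> 0 \<le> s"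
    then have "s < 0" by simp
    define t where "t = min (v - 1) ((c + 1) / s)"
    have "s * t \<le> c" using T_le[OF T_I[of t 0]] by (simp add: t_def)
    moreover have "s * t \<ge> s * ((c + 1) / s)"
      using \<open>s < 0\<close> by (intro mult_left_mono_neg) (auto simp: t_def)
    ultimately show False using \<open>s < 0\<close> by simp
  qed
  \<comment> \<open>A vertical hyperplane would bound \<open>b \<bullet> a\<close> for every
    \<open>a\<close>, forcing \<open>b = 0\<close> and hence \<open>n = 0\<close>.\<close>
  moreover have "s \<noteq> 0"
  proof
    assume "s = 0"
    have *: "b \<bullet> a \<le> c" for a
      using T_le[OF T_I[of "v - R * norm a - 1" a]] by (simp add: \<open>s = 0\<close>)
    have "b \<noteq> 0" using n(1) \<open>s = 0\<close> by (simp add: b_def s_def prod_eq_iff)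
    then have "b \<bullet> (((c + 1) / (b \<bullet> b)) *\<^sub>R b) = c + 1" by simp
    then show False using *[of "((c + 1) / (b \<bullet> b)) *\<^sub>R b"] by linarith
  qed
  ultimately have "0 < s" by simp
  define p where "p = (1 / s) *\<^sub>R b"
  have b: "b = s *\<^sub>R p" using \<open>0 < s\<close> by (simp add: p_def)
  have T_le': "p \<bullet> a + t \<le> c / s" if "(a, t) \<in> T" for a t
    using T_le[OF that] \<open>0 < s\<close> by (simp add: b field_simps)
  have "p \<in> P"
  proof (rule ccontr)
    assume "p \<notin> P"
    obtain a \<beta> where a: "a \<bullet> p < \<beta>" "\<forall>x\<in>P. \<beta> < a \<bullet> x"
      using separating_hyperplane_closed_point[OF P(2) compact_imp_closed[OF P(1)] \<open>p \<notin> P\<close>] by blast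
    \<comment> \<open>The affine function \<pi> \<mapsto>
      \<open>k * (\<beta> - a \<bullet> \<pi>) + v - 1\<close> stays below \<open>v\<close> on
      \<open>P\<close>, so it belongs to \<open>T\<close>. This \<open>k\<close> makes its value at
      \<open>p\<close> equal to \<open>\<bar>c / s - v\<bar> + v + 1\<close>, which exceeds
      \<open>c / s\<close>.\<close>
    define k where "k = (\<bar>c / s - v\<bar> + 2) / (\<beta> - a \<bullet> p)"
    have "0 \<le> k" using a(1) by (simp add: k_def)
    have "\<pi> \<bullet> (- k *\<^sub>R a) + (v - 1 + k * \<beta>) < v" if "\<pi> \<in> P" for \<pi>
    proof -
      have "k * \<beta> \<le> k * (a \<bullet> \<pi>)" using a(2) that \<open>0 \<le> k\<close> by (intro mult_left_mono) force+
      then show ?thesis by (simp add: inner_commute)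
    qed
    then have "(- k *\<^sub>R a, v - 1 + k * \<beta>) \<in> T" by (simp add: T_def)
    then have "k * (\<beta> - a \<bullet> p) + v - 1 \<le> c / s"
      using T_le' by (force simp: algebra_simps inner_commute)
    moreover have "k * (\<beta> - a \<bullet> p) = \<bar>c / s - v\<bar> + 2"
      using a(1) by (simp add: k_def)
    ultimately show False by linarith
  qed
  moreover have "v \<le> p \<bullet> (d + L \<xi>) + h \<xi>" if "\<xi> \<in> Q" for \<xi>
  proof -
    \<comment> \<open>Every constant function with value below \<open>v\<close> lies in
      \<open>T\<close>, so \<open>c / s\<close> is at least each such value.\<close>
    have "v \<le> c / s"
      by (rule dense_le) (use T_le'[OF T_I[of _ 0]] in simp)
    also have "\<dots> \<le> p \<bullet> (d + L \<xi>) + h \<xi>"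
      using S_ge[OF that] \<open>0 < s\<close> by (simp add: b field_simps)
    finally show ?thesis .
  qed
  ultimately show thesis using that by blast
qed

text \<open>The point \<open>q\<close> holds the planner to the min-max value \<open>v\<close> and
  \<open>p\<close> secures at least \<open>v\<close>, so both meet at \<open>f p q = v\<close>. The
  formula for \<open>f\<close> is assumed on \<open>P \<times> Q\<close> alone because the game
  payoff takes this form on feasible pairs; \<open>F\<close> extends it to all arguments.\<close>

lemma linear_convex_saddle_point:
  fixes L :: "'b::euclidean_space \<Rightarrow> 'a::euclidean_space"
  assumes P: "compact P" "convex P" "P \<noteq> {}" and Q: "compact Q" "convex Q" "Q \<noteq> {}"
    and L: "linear L" and h: "convex_on Q h" "continuous_on Q h"
    and f: "\<And>\<pi> \<xi>. \<pi> \<in> P \<Longrightarrow> \<xi> \<in> Q \<Longrightarrow> f \<pi> \<xi> = \<pi> \<bullet> (d + L \<xi>) + h \<xi>"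
  obtains p q where "p \<in> P" "q \<in> Q"
    "\<And>\<pi>. \<pi> \<in> P \<Longrightarrow> f \<pi> q \<le> f p q" "\<And>\<xi>. \<xi> \<in> Q \<Longrightarrow> f p q \<le> f p \<xi>"
proof -
  define F where "F \<pi> \<xi> = \<pi> \<bullet> (d + L \<xi>) + h \<xi>" for \<pi> \<xi>
  have cont_P: "continuous_on P (\<lambda>\<pi>. F \<pi> \<xi>)" for \<xi>
    unfolding F_def by (intro continuous_intros)
  have cont_Q: "continuous_on Q (F \<pi>)" for \<pi>
    unfolding F_def by (intro continuous_intros linear_continuous_on_compose[OF _ L] h)
  have bdd: "bdd_above ((\<lambda>\<pi>. F \<pi> \<xi>) ` P)" for \<xi>
    by (intro bounded_imp_bdd_above compact_imp_bounded compact_continuous_image cont_P P)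
  obtain v q where q: "q \<in> Q" "\<And>\<pi>. \<pi> \<in> P \<Longrightarrow> F \<pi> q \<le> v"
    and v: "\<And>\<xi> c. \<xi> \<in> Q \<Longrightarrow> (\<And>\<pi>. \<pi> \<in> P \<Longrightarrow> F \<pi> \<xi> \<le> c) \<Longrightarrow> v \<le> c"
    using min_max_attained[OF Q(1,3) P(3) bdd cont_Q] by metis
  \<comment> \<open>The maximum over the compact set \<open>P\<close> is an upper bound, so
    minimality of \<open>v\<close> applies to it.\<close>
  have "\<exists>\<pi>\<in>P. v \<le> F \<pi> \<xi>" if "\<xi> \<in> Q" for \<xi>
    using continuous_attains_sup[OF P(1,3) cont_P] v[OF that] by metis
  then obtain p where p: "p \<in> P" "\<And>\<xi>. \<xi> \<in> Q \<Longrightarrow> v \<le> F p \<xi>"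
    using maximin_strategy[OF P(1,2) Q(2,3) L h(1), of v d] unfolding F_def by metis
  have "f \<pi> q \<le> f p q" if "\<pi> \<in> P" for \<pi>
    using q(2)[OF that] p(2)[OF q(1)] f[OF that q(1)] f[OF p(1) q(1)] by (simp add: F_def)
  moreover have "f p q \<le> f p \<xi>" if "\<xi> \<in> Q" for \<xi>
    using q(2)[OF p(1)] p(2)[OF that] f[OF p(1) that] f[OF p(1) q(1)] by (simp add: F_def)
  ultimately show thesis using that p(1) q(1) by blast
qed

section \<open>Compactness and convexity of the strategy sets\<close>

text \<open>The set is an intersection of closed coordinate preimages, and the norm of a member is
  at most the sum of the bounds of the factors.\<close>

lemma compact_vec_product:
  fixes B :: "'i::finite \<Rightarrow> 'a::euclidean_space set"
  assumes "\<And>i. compact (B i)"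
  shows "compact {x :: 'a ^ 'i. \<forall>i. x $ i \<in> B i}"
proof -
  have "\<exists>R. \<forall>v\<in>B i. norm v \<le> R" for i
    using compact_imp_bounded[OF assms] by (auto simp: bounded_iff)
  then obtain R where R: "\<And>i v. v \<in> B i \<Longrightarrow> norm v \<le> R i" by metis
  have "norm x \<le> (\<Sum>i\<in>UNIV. R i)" if "\<forall>i. x $ i \<in> B i" for x :: "'a ^ 'i"
  proof -
    have "norm x \<le> (\<Sum>i\<in>UNIV. norm (x $ i))"
      unfolding norm_vec_def by (rule L2_set_le_sum) simp
    also have "\<dots> \<le> (\<Sum>i\<in>UNIV. R i)" using that R by (intro sum_mono) auto
    finally show ?thesis .
  qed
  then have "bounded {x :: 'a ^ 'i. \<forall>i. x $ i \<in> B i}" by (auto simp: bounded_iff)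
  moreover have "closed ((\<lambda>x :: 'a ^ 'i. x $ i) -` B i)" for i
    by (intro closed_vimage compact_imp_closed assms continuous_intros)
  then have "closed (\<Inter>i. (\<lambda>x :: 'a ^ 'i. x $ i) -` B i)" by blast
  moreover have "(\<Inter>i. (\<lambda>x :: 'a ^ 'i. x $ i) -` B i) = {x. \<forall>i. x $ i \<in> B i}" by auto
  ultimately show ?thesis by (simp add: compact_eq_bounded_closed)
qed

lemma convex_vec_product:
  assumes "\<And>i. convex (B i)"
  shows "convex {x :: 'a::real_vector ^ 'i::finite. \<forall>i. x $ i \<in> B i}"
  using assms by (auto simp: convex_def)

lemma convex_linear_level_sets:
  fixes g :: "'a::real_vector \<Rightarrow> real"
  assumes "linear g"
  shows "convex {x. c \<le> g x}" "convex {x. g x \<le> c}"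
proof -
  have "{x. c \<le> g x} = g -` {c..}" "{x. g x \<le> c} = g -` {..c}" by auto
  then show "convex {x. c \<le> g x}" "convex {x. g x \<le> c}"
    by (simp_all add: convex_linear_vimage[OF assms])
qed

text \<open>As an intersection of closed half-spaces the set inherits convexity and closedness
  factor by factor; the zero entries off the edges are split into two inequalities for this
  purpose.\<close>

lemma plans_eq:
  "plans G =
     (\<Inter>x. {\<pi>. p_lower G x \<le> (\<Sum>y\<in>sources_of G x. \<pi> $ x $ y)} \<inter>
          {\<pi>. (\<Sum>y\<in>sources_of G x. \<pi> $ x $ y) \<le> p_upper G x}) \<inter>
     (\<Inter>y. {\<pi>. q_lower G y \<le> (\<Sum>x\<in>targets_of G y. \<pi> $ x $ y)} \<inter>
          {\<pi>. (\<Sum>x\<in>targets_of G y. \<pi> $ x $ y) \<le> q_upper G y}) \<inter>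
     (\<Inter>(x, y)\<in>edges G. {\<pi>. 0 \<le> \<pi> $ x $ y}) \<inter>
     (\<Inter>(x, y)\<in>- edges G. {\<pi>. 0 \<le> \<pi> $ x $ y} \<inter> {\<pi>. \<pi> $ x $ y \<le> 0})"
  unfolding plans_def by (force intro: antisym)

lemma convex_plans:
  fixes G :: "('x::finite, 'y::finite) transport_game"
  shows "convex (plans G)"
proof -
  have lin: "linear (\<lambda>\<pi> :: real ^ 'y ^ 'x. \<pi> $ x $ y)" for x y
    by (simp add: linear_iff)
  show ?thesis
    unfolding plans_eq split_beta
    by (intro convex_Int convex_INT convex_linear_level_sets linear_compose_sum ballI lin)
qed

lemma compact_plans:
  fixes G :: "('x::finite, 'y::finite) transport_game"
  shows "compact (plans G)"
proof -
  have closed: "closed (plans G)"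
    unfolding plans_eq split_beta
    by (intro closed_Int closed_INT ballI closed_Collect_le continuous_intros)
  \<comment> \<open>Entries of a plan are nonnegative on edges and zero elsewhere, so the l1 norm of
    a row is its row sum, which \<open>p_upper\<close> bounds.\<close>
  have subset: "plans G \<subseteq> {\<pi>. \<forall>x. \<pi> $ x \<in> cball 0 (p_upper G x)}"
  proof (intro subsetI CollectI allI)
    fix \<pi> and x :: 'x assume \<pi>: "\<pi> \<in> plans G"
    have "norm (\<pi> $ x) \<le> (\<Sum>y\<in>UNIV. \<bar>\<pi> $ x $ y\<bar>)" by (rule norm_le_l1_cart)
    also have "\<dots> = (\<Sum>y\<in>sources_of G x. \<pi> $ x $ y)"
      using \<pi> by (intro sum.mono_neutral_cong_right) (auto simp: plans_def sources_of_def)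
    also have "\<dots> \<le> p_upper G x" using \<pi> by (simp add: plans_def)
    finally show "\<pi> $ x \<in> cball 0 (p_upper G x)" by simp
  qed
  have "compact {\<pi> :: real ^ 'y ^ 'x. \<forall>x. \<pi> $ x \<in> cball 0 (p_upper G x)}"
    by (rule compact_vec_product) (rule compact_cball)
  from compact_Int_closed[OF this closed] show ?thesis
    by (simp only: Int_absorb1[OF subset])
qed

text \<open>Validity places each action set inside \<open>source_vectors\<close>, so the zeros off
  the edges come for free on compromised rows and the attacks form a product over the rows.\<close>

lemma attacks_eq:
  assumes "valid_game G"
  shows "attacks G = {\<xi>. \<forall>x. \<xi> $ x \<in> (if x \<in> compromised G then actions G x else {0})}"
proof -
  have "v $ y = 0" if "x \<in> compromised G" "v \<in> actions G x" "(x, y) \<notin> edges G" for v x y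
  proof -
    have "v \<in> source_vectors G x" using assms that by (auto simp: valid_game_def)
    then show ?thesis using that(3) by (simp add: source_vectors_def sources_of_def)
  qed
  then show ?thesis
    unfolding attacks_def by (intro Collect_cong) (auto simp: vec_eq_iff split: if_splits)
qed

section \<open>Normal form of the payoff and existence of a saddle point\<close>

text \<open>A plan vanishes off the edges, so neighbourhood sums extend to all pairs. An attack
  vanishes on uncompromised rows, so \<open>delta + \<xi>\<close> may serve as the coefficient on
  every row.\<close>

lemma payoff_eq:
  assumes "\<pi> \<in> plans G" "\<xi> \<in> attacks G"
  shows "payoff G \<pi> \<xi> = \<pi> \<bullet> ((\<chi> x y. delta G x y + gamma G x y) + \<xi>) +
    attack_cost G * (\<Sum>x\<in>compromised G. \<Sum>y\<in>sources_of G x. \<bar>\<xi> $ x $ y\<bar>)"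
proof -
  have \<pi>0: "\<pi> $ x $ y = 0" if "(x, y) \<notin> edges G" for x y
    using assms(1) that by (simp add: plans_def)
  have \<xi>0: "\<xi> $ x $ y = 0" if "x \<notin> compromised G" for x y
    using assms(2) that by (simp add: attacks_def)
  have row: "(\<Sum>y\<in>sources_of G x. k y * \<pi> $ x $ y) = (\<Sum>y\<in>UNIV. k y * \<pi> $ x $ y)" for x k
    by (rule sum.mono_neutral_left) (auto simp: sources_of_def \<pi>0)
  have col: "(\<Sum>x\<in>targets_of G y. gamma G x y * \<pi> $ x $ y) = (\<Sum>x\<in>UNIV. gamma G x y * \<pi> $ x $ y)" for y
    by (rule sum.mono_neutral_left) (auto simp: targets_of_def \<pi>0)
  have "(\<Sum>x\<in>- compromised G. \<Sum>y\<in>UNIV. delta G x y * \<pi> $ x $ y) +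
      (\<Sum>x\<in>compromised G. \<Sum>y\<in>UNIV. (delta G x y + \<xi> $ x $ y) * \<pi> $ x $ y) =
      (\<Sum>x\<in>- compromised G. \<Sum>y\<in>UNIV. (delta G x y + \<xi> $ x $ y) * \<pi> $ x $ y) +
      (\<Sum>x\<in>compromised G. \<Sum>y\<in>UNIV. (delta G x y + \<xi> $ x $ y) * \<pi> $ x $ y)"
    by (simp add: \<xi>0)
  also have "\<dots> = (\<Sum>x\<in>UNIV. \<Sum>y\<in>UNIV. (delta G x y + \<xi> $ x $ y) * \<pi> $ x $ y)"
    by (subst sum.union_disjoint[symmetric]) (auto simp: Un_commute)
  moreover have "(\<Sum>y\<in>UNIV. \<Sum>x\<in>UNIV. gamma G x y * \<pi> $ x $ y) =
      (\<Sum>x\<in>UNIV. \<Sum>y\<in>UNIV. gamma G x y * \<pi> $ x $ y)"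
    by (rule sum.swap)
  ultimately show ?thesis
    unfolding payoff_def row col by (simp add: inner_vec_def algebra_simps sum.distrib)
qed

lemma continuous_on_payoff:
  "continuous_on A (\<lambda>\<pi>. payoff G \<pi> \<xi>)" "continuous_on A (\<lambda>\<xi>. payoff G \<pi> \<xi>)"
  unfolding payoff_def by (intro continuous_intros)+

lemma inner_optima_attainedI:
  assumes "compact (plans G)" "plans G \<noteq> {}" "compact (attacks G)" "attacks G \<noteq> {}"
  shows "inner_optima_attained G"
  unfolding inner_optima_attained_def is_arg_min_def is_arg_max_def
  using continuous_attains_inf[OF assms(3,4) continuous_on_payoff(2)]
    continuous_attains_sup[OF assms(1,2) continuous_on_payoff(1)]
  by (metis not_less)

text \<open>Instance of the minimax theorem with the identity as linear map. The cost
  \<open>h\<close> is convex by the triangle inequality and because \<open>attack_cost G\<close> is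
  nonnegative.\<close>

lemma saddle_point_exists:
  fixes G :: "('x::finite, 'y::finite) transport_game"
  assumes G: "valid_game G" "plans G \<noteq> {}" and Q: "compact (attacks G)" "convex (attacks G)" "attacks G \<noteq> {}"
  shows "\<exists>\<pi> \<xi>. saddle_point G \<pi> \<xi>"
proof -
  define h where "h \<xi> = attack_cost G * (\<Sum>x\<in>compromised G. \<Sum>y\<in>sources_of G x. \<bar>\<xi> $ x $ y\<bar>)"
    for \<xi> :: "real ^ 'y ^ 'x"
  have "convex_on (attacks G) h"
  proof (rule convex_onI)
    fix t :: real and \<xi> \<eta> :: "real ^ 'y ^ 'x"
    assume t: "0 < t" "t < 1"
    have "(\<Sum>x\<in>compromised G. \<Sum>y\<in>sources_of G x. \<bar>((1 - t) *\<^sub>R \<xi> + t *\<^sub>R \<eta>) $ x $ y\<bar>)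
        \<le> (\<Sum>x\<in>compromised G. \<Sum>y\<in>sources_of G x. (1 - t) * \<bar>\<xi> $ x $ y\<bar> + t * \<bar>\<eta> $ x $ y\<bar>)"
    proof (intro sum_mono)
      fix x y
      show "\<bar>((1 - t) *\<^sub>R \<xi> + t *\<^sub>R \<eta>) $ x $ y\<bar> \<le> (1 - t) * \<bar>\<xi> $ x $ y\<bar> + t * \<bar>\<eta> $ x $ y\<bar>"
        using t abs_triangle_ineq[of "(1 - t) * \<xi> $ x $ y" "t * \<eta> $ x $ y"] by (simp add: abs_mult)
    qed
    also have "\<dots> = (1 - t) * (\<Sum>x\<in>compromised G. \<Sum>y\<in>sources_of G x. \<bar>\<xi> $ x $ y\<bar>) +
        t * (\<Sum>x\<in>compromised G. \<Sum>y\<in>sources_of G x. \<bar>\<eta> $ x $ y\<bar>)"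
      by (simp add: sum.distrib sum_distrib_left)
    finally have "h ((1 - t) *\<^sub>R \<xi> + t *\<^sub>R \<eta>) \<le> attack_cost G * \<dots>"
      unfolding h_def using G(1) by (intro mult_left_mono) (auto simp: valid_game_def)
    then show "h ((1 - t) *\<^sub>R \<xi> + t *\<^sub>R \<eta>) \<le> (1 - t) * h \<xi> + t * h \<eta>"
      by (simp add: h_def algebra_simps)
  qed (rule Q)
  moreover have "continuous_on (attacks G) h"
    unfolding h_def by (intro continuous_intros)
  ultimately obtain \<pi> \<xi> where "\<pi> \<in> plans G" "\<xi> \<in> attacks G"
    "\<And>\<pi>'. \<pi>' \<in> plans G \<Longrightarrow> payoff G \<pi>' \<xi> \<le> payoff G \<pi> \<xi>"
    "\<And>\<xi>'. \<xi>' \<in> attacks G \<Longrightarrow> payoff G \<pi> \<xi> \<le> payoff G \<pi> \<xi>'"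
    by (rule linear_convex_saddle_point[OF compact_plans convex_plans G(2) Q linear_id,
          where h = h and f = "payoff G" and d = "\<chi> x y. delta G x y + gamma G x y"])
      (simp_all add: payoff_eq h_def)
  then show ?thesis unfolding saddle_point_def by blast
qed

section \<open>Optimality and common value of both problems at a saddle point\<close>

text \<open>For each feasible \<pi>', \<open>min_payoff G \<pi>' \<le> payoff G \<pi>' \<xi> \<le>
  payoff G \<pi> \<xi>\<close>, with equality at \<pi>; the other side is dual. Attained inner
  optima supply the boundedness that makes these real infima and suprema meaningful.\<close>

lemma saddle_point_values:
  assumes "inner_optima_attained G" "saddle_point G \<pi> \<xi>"
  shows "is_arg_max (min_payoff G) (\<lambda>\<pi>. \<pi> \<in> plans G) \<pi>" "(SUP \<pi>\<in>plans G. min_payoff G \<pi>) = payoff G \<pi> \<xi>"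
    "is_arg_min (max_payoff G) (\<lambda>\<xi>. \<xi> \<in> attacks G) \<xi>" "(INF \<xi>\<in>attacks G. max_payoff G \<xi>) = payoff G \<pi> \<xi>"
proof -
  have \<pi>: "\<pi> \<in> plans G" and \<xi>: "\<xi> \<in> attacks G"
    and le: "\<And>\<pi>'. \<pi>' \<in> plans G \<Longrightarrow> payoff G \<pi>' \<xi> \<le> payoff G \<pi> \<xi>"
    and ge: "\<And>\<xi>'. \<xi>' \<in> attacks G \<Longrightarrow> payoff G \<pi> \<xi> \<le> payoff G \<pi> \<xi>'"
    using assms(2) by (auto simp: saddle_point_def)
  have "bdd_below (payoff G \<pi>' ` attacks G)" if "\<pi>' \<in> plans G" for \<pi>'
    using assms(1) that
    unfolding inner_optima_attained_def is_arg_min_def bdd_below_def not_less[symmetric] by blast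
  then have min_le: "min_payoff G \<pi>' \<le> payoff G \<pi> \<xi>" if "\<pi>' \<in> plans G" for \<pi>'
    unfolding min_payoff_def by (rule cINF_lower2[of _ _ \<xi>]) (use \<xi> le that in blast)+
  have "bdd_above ((\<lambda>\<pi>. payoff G \<pi> \<xi>') ` plans G)" if "\<xi>' \<in> attacks G" for \<xi>'
    using assms(1) that
    unfolding inner_optima_attained_def is_arg_max_def bdd_above_def not_less[symmetric] by blast
  then have max_ge: "payoff G \<pi> \<xi> \<le> max_payoff G \<xi>'" if "\<xi>' \<in> attacks G" for \<xi>'
    unfolding max_payoff_def by (rule cSUP_upper2[of _ _ \<pi>]) (use \<pi> ge that in blast)+
  have min_eq: "min_payoff G \<pi> = payoff G \<pi> \<xi>"
    unfolding min_payoff_def using \<xi> ge by (intro cInf_eq_minimum) auto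
  have max_eq: "max_payoff G \<xi> = payoff G \<pi> \<xi>"
    unfolding max_payoff_def using \<pi> le by (intro cSup_eq_maximum) auto
  show "is_arg_max (min_payoff G) (\<lambda>\<pi>. \<pi> \<in> plans G) \<pi>"
    using \<pi> min_le min_eq by (auto simp: is_arg_max_def not_less)
  show "(SUP \<pi>\<in>plans G. min_payoff G \<pi>) = payoff G \<pi> \<xi>"
    by (rule cSup_eq_maximum) (use \<pi> min_le min_eq in \<open>force+\<close>)
  show "is_arg_min (max_payoff G) (\<lambda>\<xi>. \<xi> \<in> attacks G) \<xi>"
    using \<xi> max_ge max_eq by (auto simp: is_arg_min_def not_less)
  show "(INF \<xi>\<in>attacks G. max_payoff G \<xi>) = payoff G \<pi> \<xi>"
    by (rule cInf_eq_minimum) (use \<xi> max_ge max_eq in \<open>force+\<close>)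
qed

section \<open>A game with several equilibria\<close>

text \<open>On the complete bipartite graph the upper bounds are exactly the row and column sums of
  the all-ones matrix, so that this matrix is a plan besides 0. The payoff vanishes on feasible
  pairs, which makes each of them a saddle point.\<close>

definition zero_game :: "('x::finite, 'y::finite) transport_game" where
  "zero_game = \<lparr>edges = UNIV, compromised = UNIV, delta = (\<lambda>_ _. 0), gamma = (\<lambda>_ _. 0),
     p_lower = (\<lambda>_. 0), p_upper = (\<lambda>_. real CARD('y)),
     q_lower = (\<lambda>_. 0), q_upper = (\<lambda>_. real CARD('x)), attack_cost = 0, actions = (\<lambda>_. {0})\<rparr>"

lemma zero_game_saddle_points:
  "saddle_point (zero_game :: ('x::finite, 'y::finite) transport_game) 0 0"
  "saddle_point (zero_game :: ('x::finite, 'y::finite) transport_game) (\<chi> x y. 1) 0"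
  by (auto simp: saddle_point_def plans_def attacks_def payoff_def zero_game_def
      sources_of_def targets_of_def)

section \<open>Equality of the two problems, existence and non-uniqueness\<close>

theorem proposition1:
  "(\<forall>G :: ('x::finite, 'y::finite) transport_game.
      valid_game G \<longrightarrow> plans G \<noteq> {} \<longrightarrow>
      (\<forall>x\<in>compromised G. actions G x \<noteq> {} \<and> compact (actions G x) \<and> convex (actions G x)) \<longrightarrow>
        inner_optima_attained G \<and>
        (SUP \<pi>\<in>plans G. INF \<xi>\<in>attacks G. payoff G \<pi> \<xi>) =
          (INF \<xi>\<in>attacks G. SUP \<pi>\<in>plans G. payoff G \<pi> \<xi>) \<and>
        (\<exists>\<pi> \<xi>. max_min_solution G \<pi> \<xi> \<and> min_max_solution G \<pi> \<xi>) \<and>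
        (\<exists>\<pi> \<xi>. saddle_point G \<pi> \<xi>)) \<and>
   (\<exists>(G :: ('x, 'y) transport_game) \<kappa>.
      valid_game G \<and> compromised G \<noteq> {} \<and>
      (\<forall>x\<in>compromised G. 0 \<le> \<kappa> x \<and> actions G x = ball_actions G (\<kappa> x) x) \<and>
      (\<exists>\<pi> \<xi> \<pi>' \<xi>'. saddle_point G \<pi> \<xi> \<and> saddle_point G \<pi>' \<xi>' \<and> (\<pi>, \<xi>) \<noteq> (\<pi>', \<xi>')))"
proof (intro conjI[of "All _"] allI impI)
  fix G :: "('x, 'y) transport_game"
  assume G: "valid_game G" "plans G \<noteq> {}"
    and act: "\<forall>x\<in>compromised G. actions G x \<noteq> {} \<and> compact (actions G x) \<and> convex (actions G x)"
  let ?B = "\<lambda>x. if x \<in> compromised G then actions G x else {0}"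
  have "compact (attacks G)" "convex (attacks G)"
    unfolding attacks_eq[OF G(1)] using act
    by (intro compact_vec_product convex_vec_product; simp)+
  moreover have "attacks G \<noteq> {}"
  proof -
    have "(\<chi> x. SOME v. v \<in> ?B x) \<in> attacks G"
      unfolding attacks_eq[OF G(1)] using act by (auto simp: some_in_eq)
    then show ?thesis by blast
  qed
  ultimately have opt: "inner_optima_attained G" and "\<exists>\<pi> \<xi>. saddle_point G \<pi> \<xi>"
    using inner_optima_attainedI[OF compact_plans G(2)] saddle_point_exists[OF G] by blast+
  then obtain \<pi> \<xi> where s: "saddle_point G \<pi> \<xi>" by blast
  note vals = saddle_point_values[OF opt s]
  \<comment> \<open>The same saddle point solves both problems: its outer optimality is in
    \<open>vals\<close>, its inner optimality is the saddle inequality.\<close>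
  have "max_min_solution G \<pi> \<xi>" "min_max_solution G \<pi> \<xi>"
    unfolding max_min_solution_def min_max_solution_def
    using vals(1,3) s by (auto simp: saddle_point_def is_arg_min_def is_arg_max_def not_less)
  then show "inner_optima_attained G \<and>
        (SUP \<pi>\<in>plans G. INF \<xi>\<in>attacks G. payoff G \<pi> \<xi>) =
          (INF \<xi>\<in>attacks G. SUP \<pi>\<in>plans G. payoff G \<pi> \<xi>) \<and>
        (\<exists>\<pi> \<xi>. max_min_solution G \<pi> \<xi> \<and> min_max_solution G \<pi> \<xi>) \<and>
        (\<exists>\<pi> \<xi>. saddle_point G \<pi> \<xi>)"
    using opt s vals(2,4) unfolding min_payoff_def max_payoff_def by auto
next
  let ?G = "zero_game :: ('x, 'y) transport_game"
  \<comment> \<open>With \<open>\<kappa> = 0\<close> the ball consists of the zero vector, so the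
    action sets \<open>{0}\<close> have the required form.\<close>
  have "valid_game ?G" "compromised ?G \<noteq> {}"
    "\<forall>x\<in>compromised ?G. 0 \<le> (0::real) \<and> actions ?G x = ball_actions ?G 0 x"
    by (auto simp: valid_game_def zero_game_def sources_of_def targets_of_def source_vectors_def
        ball_actions_def)
  moreover have "\<exists>\<pi> \<xi> \<pi>' \<xi>'. saddle_point ?G \<pi> \<xi> \<and> saddle_point ?G \<pi>' \<xi>' \<and> (\<pi>, \<xi>) \<noteq> (\<pi>', \<xi>')"
  proof (rule exI, rule exI, rule exI, rule exI, intro conjI)
    show "saddle_point ?G 0 0" "saddle_point ?G (\<chi> x y. 1) 0"
      by (rule zero_game_saddle_points)+
    show "(0, 0) \<noteq> ((\<chi> x y. 1) :: real ^ 'y ^ 'x, 0 :: real ^ 'y ^ 'x)"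
      by (simp add: vec_eq_iff)
  qed
  ultimately show "\<exists>(G :: ('x, 'y) transport_game) \<kappa>.
      valid_game G \<and> compromised G \<noteq> {} \<and>
      (\<forall>x\<in>compromised G. 0 \<le> \<kappa> x \<and> actions G x = ball_actions G (\<kappa> x) x) \<and>
      (\<exists>\<pi> \<xi> \<pi>' \<xi>'. saddle_point G \<pi> \<xi> \<and> saddle_point G \<pi>' \<xi>' \<and> (\<pi>, \<xi>) \<noteq> (\<pi>', \<xi>'))"
    by (intro exI[of _ ?G] exI[of _ "\<lambda>_. 0"] conjI)
qed

end
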